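(* Let $K$ be a field, $K[X]=K[x_1,\ldots,x_n]$, let $G$ be a subgroup of the symmetric group $\mathfrak{S}_n$, let $I$ be a proper $G$-invariant ideal of $K[X]$ and let $\sigma\in G$. For a primary decomposition $\mathcal{Q}=\{Q_1,\ldots,Q_k\}$ of $I$, $\sigma(\mathcal{Q})=\{\sigma(Q_1),\ldots,\sigma(Q_k)\}$ is also a primary decomposition of $I$. If $\mathcal{Q}$ is minimal, then $\sigma(\mathcal{Q})$ is also minimal.
   Context: The group $\mathfrak{S}_n$ acts on $K[X]$ by $\sigma(f(x_1,\ldots,x_n))=f(x_{\sigma(1)},\ldots,x_{\sigma(n)})$; for an ideal $I$, $\sigma(I)=\{\sigma(f)\mid f\in I\}$. An ideal $I$ is $G$-invariant if $\sigma(I)=I$ for all $\sigma\in G$. A primary decomposition of a proper ideal $I$ is a finite set $\{Q_1,\ldots,Q_k\}$ of primary ideals with $I=Q_1\cap\cdots\cap Q_k$; it is minimal if $\sqrt{Q_i}\neq\sqrt{Q_j}$ for $i\ne j$ and $Q_i\not\supset\bigcap_{j\neq i}Q_j$ for every $i$. *)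

theory Defs
  imports
    "HOL-Library.Poly_Mapping"
    "HOL-Algebra.Ideal"
    "HOL-Algebra.Sym_Groups"
begin

section \<open>Multivariate polynomials\<close>

text \<open>
  Finitely supported maps \<open>nat \<Rightarrow>\<^sub>0 nat\<close> are exponent vectors of monomials, and polynomials are
  finitely supported maps from monomials to coefficients, with the convolution product of
  \<^theory>\<open>HOL-Library.Poly_Mapping\<close>. The variables of \<open>K[x\<^sub>1,\<dots>,x\<^sub>n]\<close> are numbered by \<open>{1..n}\<close>,
  the set on which \<^const>\<open>sym_group\<close> acts.
\<close>

type_synonym 'k mvpoly = "(nat \<Rightarrow>\<^sub>0 nat) \<Rightarrow>\<^sub>0 'k"

definition mvpoly_ring :: "nat \<Rightarrow> 'k::field mvpoly ring" where
  "mvpoly_ring n =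
     \<lparr> carrier = {f. \<forall>m \<in> Poly_Mapping.keys f. Poly_Mapping.keys m \<subseteq> {1..n}},
       monoid.mult = (*), one = 1, zero = 0, add = (+) \<rparr>"

definition mvpoly_const :: "'k::field \<Rightarrow> 'k mvpoly" where
  "mvpoly_const c = Poly_Mapping.single 0 c"

definition mvpoly_var :: "nat \<Rightarrow> 'k::field mvpoly" where
  "mvpoly_var i = Poly_Mapping.single (Poly_Mapping.single i 1) 1"

definition mvpoly_subst :: "'k::field mvpoly \<Rightarrow> (nat \<Rightarrow> 'k mvpoly) \<Rightarrow> 'k mvpoly" where
  "mvpoly_subst f g =
     (\<Sum>m \<in> Poly_Mapping.keys f.
        mvpoly_const (Poly_Mapping.lookup f m) *
        (\<Prod>i \<in> Poly_Mapping.keys m. g i ^ Poly_Mapping.lookup m i))"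

definition perm_act :: "(nat \<Rightarrow> nat) \<Rightarrow> 'k::field mvpoly \<Rightarrow> 'k mvpoly" where
  "perm_act \<sigma> f = mvpoly_subst f (\<lambda>i. mvpoly_var (\<sigma> i))"

definition perm_invariant :: "(nat \<Rightarrow> nat) set \<Rightarrow> 'k::field mvpoly set \<Rightarrow> bool" where
  "perm_invariant G I \<longleftrightarrow> (\<forall>\<sigma> \<in> G. perm_act \<sigma> ` I = I)"

lemma mvpoly_ring_cring: "cring (mvpoly_ring n :: 'k::field mvpoly ring)"
proof -
  let ?R = "mvpoly_ring n :: 'k mvpoly ring"
  have add: "f + g \<in> carrier ?R" if "f \<in> carrier ?R" "g \<in> carrier ?R" for f g
    using that Poly_Mapping.keys_add[of f g] unfolding mvpoly_ring_def by auto
  have mult: "f * g \<in> carrier ?R" if fg: "f \<in> carrier ?R" "g \<in> carrier ?R" for f g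
  proof -
    have "Poly_Mapping.keys m \<subseteq> {1..n}" if m: "m \<in> Poly_Mapping.keys (f * g)" for m
    proof -
      obtain a b where "m = a + b" "a \<in> Poly_Mapping.keys f" "b \<in> Poly_Mapping.keys g"
        using m Poly_Mapping.keys_mult[of f g] by blast
      moreover from this fg have "Poly_Mapping.keys a \<subseteq> {1..n}" "Poly_Mapping.keys b \<subseteq> {1..n}"
        by (simp_all add: mvpoly_ring_def)
      ultimately show ?thesis using Poly_Mapping.keys_add[of a b] by blast
    qed
    then show ?thesis by (simp add: mvpoly_ring_def)
  qed
  have uminus: "- f \<in> carrier ?R" if "f \<in> carrier ?R" for f
    using that unfolding mvpoly_ring_def by (simp add: in_keys_iff)
  have zero_one: "0 \<in> carrier ?R" "1 \<in> carrier ?R"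
    by (simp_all add: mvpoly_ring_def)
  have ops: "x \<oplus>\<^bsub>?R\<^esub> y = x + y" "x \<otimes>\<^bsub>?R\<^esub> y = x * y" "\<zero>\<^bsub>?R\<^esub> = 0" "\<one>\<^bsub>?R\<^esub> = 1" for x y
    by (simp_all add: mvpoly_ring_def)
  show ?thesis
  proof (rule cringI)
    show "abelian_group ?R"
      by (rule abelian_groupI; unfold ops)
        (blast intro: add zero_one | metis uminus left_minus | simp add: add.assoc
         | simp add: add.commute)+
    show "comm_monoid ?R"
      by (rule comm_monoidI; unfold ops)
        (blast intro: mult zero_one | simp add: mult.assoc | simp add: mult.commute)+
    show "(x \<oplus>\<^bsub>?R\<^esub> y) \<otimes>\<^bsub>?R\<^esub> z = x \<otimes>\<^bsub>?R\<^esub> z \<oplus>\<^bsub>?R\<^esub> y \<otimes>\<^bsub>?R\<^esub> z" for x y z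
      unfolding ops by (rule distrib_right)
  qed
qed


section \<open>Primary decompositions\<close>

locale primaryideal = ideal Q R + cring R for Q and R (structure) +
  assumes I_notcarr: "carrier R \<noteq> Q"
    and I_primary: "\<lbrakk>a \<in> carrier R; b \<in> carrier R; a \<otimes> b \<in> Q; a \<notin> Q\<rbrakk>
                     \<Longrightarrow> \<exists>k::nat. k > 0 \<and> b [^] k \<in> Q"

definition radical :: "('a, 'b) ring_scheme \<Rightarrow> 'a set \<Rightarrow> 'a set" where
  "radical R I = {a \<in> carrier R. \<exists>k::nat. k > 0 \<and> a [^]\<^bsub>R\<^esub> k \<in> I}"

text \<open>
  Intersecting with the carrier makes the empty intersection equal to the whole ring; it occurs in
  the irredundancy condition below when the decomposition has a single component.
\<close>

definition primary_decomposition :: "('a, 'b) ring_scheme \<Rightarrow> 'a set \<Rightarrow> 'a set set \<Rightarrow> bool" where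
  "primary_decomposition R I \<Q> \<longleftrightarrow>
     finite \<Q> \<and> (\<forall>Q \<in> \<Q>. primaryideal Q R) \<and> I = carrier R \<inter> \<Inter> \<Q>"

definition minimal_primary_decomposition ::
    "('a, 'b) ring_scheme \<Rightarrow> 'a set \<Rightarrow> 'a set set \<Rightarrow> bool" where
  "minimal_primary_decomposition R I \<Q> \<longleftrightarrow>
     primary_decomposition R I \<Q> \<and>
     (\<forall>Q \<in> \<Q>. \<forall>Q' \<in> \<Q>. Q \<noteq> Q' \<longrightarrow> radical R Q \<noteq> radical R Q') \<and>
     (\<forall>Q \<in> \<Q>. \<not> carrier R \<inter> \<Inter> (\<Q> - {Q}) \<subseteq> Q)"

end

theory Submission
  imports Defs "HOL-Algebra.QuotRing"
begin

text \<open>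
  A ring isomorphism transports ideals, primary ideals, radicals and intersections, hence (minimal)
  primary decompositions of \<open>I\<close> to (minimal) primary decompositions of the image of \<open>I\<close>. A
  permutation \<open>\<sigma>\<close> of the variables induces an automorphism of the polynomial ring with inverse
  induced by \<open>\<sigma>\<^sup>-\<^sup>1\<close>, and an invariant ideal is its own image under it.
\<close>

section \<open>Transport of primary decompositions along ring isomorphisms\<close>

lemma primary_decomposition_subset_carrier:
  assumes "primary_decomposition R I \<Q>" "Q \<in> \<Q>"
  shows "Q \<subseteq> carrier R"
proof -
  interpret primaryideal Q R
    using assms by (simp add: primary_decomposition_def)
  show ?thesis using Icarr by blast
qed

lemma image_Int_vimage_eq:
  "(\<And>x. x \<in> A \<Longrightarrow> h x \<in> C \<longleftrightarrow> x \<in> B) \<Longrightarrow> h ` (A \<inter> B) = h ` A \<inter> C"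
  by blast

text \<open>Source and target are kept apart, so that elements of \<open>R\<close> and their images
  in \<open>S\<close> are not confused; the final application takes both to be the polynomial
  ring.\<close>

locale ring_iso_cring = R: cring R + S: cring S
  for R (structure) and S (structure) +
  fixes h
  assumes iso: "h \<in> ring_iso R S"
begin

sublocale ring_hom_ring R S h
  using iso by (intro ring_hom_ringI2 R.ring_axioms S.ring_axioms) (simp add: ring_iso_def)

lemma inj: "inj_on h (carrier R)" and surj: "h ` carrier R = carrier S"
  using ring_iso_memE(5)[OF iso] by (auto simp: bij_betw_def)

lemma mem_image_iff: "x \<in> carrier R \<Longrightarrow> Q \<subseteq> carrier R \<Longrightarrow> h x \<in> h ` Q \<longleftrightarrow> x \<in> Q"
  by (rule inj_on_image_mem_iff[OF inj])

text \<open>Surjectivity is decisive for absorption: every multiplier in \<open>S\<close> has the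
  form \<open>h y\<close>, so the product is the image of a product that lies in
  \<open>Q\<close>.\<close>

lemma image_ideal:
  assumes "ideal Q R"
  shows "ideal (h ` Q) S"
proof -
  interpret Q: ideal Q R by fact
  have Qc: "Q \<subseteq> carrier R" using Q.Icarr by blast
  show ?thesis
  proof (rule idealI[OF S.ring_axioms])
    show "subgroup (h ` Q) (add_monoid S)"
      by (rule group_hom.subgroup_img_is_subgroup[OF a_group_hom Q.a_subgroup])
  next
    fix a x assume a: "a \<in> h ` Q" and x: "x \<in> carrier S"
    obtain b y where b_y: "b \<in> Q" "y \<in> carrier R" "a = h b" "x = h y"
      using a x surj by blast
    with Qc have b: "b \<in> carrier R" by blast
    have "h (y \<otimes> b) \<in> h ` Q" "h (b \<otimes> y) \<in> h ` Q"
      using b_y Q.I_l_closed Q.I_r_closed by blast+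
    then show "x \<otimes>\<^bsub>S\<^esub> a \<in> h ` Q" "a \<otimes>\<^bsub>S\<^esub> x \<in> h ` Q"
      using b_y b by simp_all
  qed
qed

lemma image_primaryideal:
  assumes "primaryideal Q R"
  shows "primaryideal (h ` Q) S"
proof -
  interpret Q: primaryideal Q R by fact
  have Qc: "Q \<subseteq> carrier R" using Q.Icarr by blast
  show ?thesis
  proof (intro primaryideal.intro primaryideal_axioms.intro image_ideal Q.ideal_axioms S.cring_axioms)
    \<comment> \<open>As \<open>carrier S\<close> is the image of \<open>carrier R\<close>, equality
      would force \<open>Q = carrier R\<close> by injectivity.\<close>
    show "carrier S \<noteq> h ` Q"
      using Q.I_notcarr inj_on_image_eq_iff[OF inj order_refl Qc] surj by metis
  next
    fix a b assume ab: "a \<in> carrier S" "b \<in> carrier S" "a \<otimes>\<^bsub>S\<^esub> b \<in> h ` Q" "a \<notin> h ` Q"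
    obtain x y where xy: "x \<in> carrier R" "y \<in> carrier R" "a = h x" "b = h y"
      using ab(1,2) surj by blast
    have "h (x \<otimes> y) \<in> h ` Q" using ab(3) xy by simp
    then have "x \<otimes> y \<in> Q" using mem_image_iff[OF _ Qc, of "x \<otimes> y"] xy(1,2) by simp
    moreover have "x \<notin> Q" using ab(4) xy by blast
    ultimately obtain k :: nat where k: "k > 0" "y [^] k \<in> Q"
      using Q.I_primary xy(1,2) by blast
    then have "h (y [^] k) \<in> h ` Q" by blast
    then show "\<exists>k::nat. k > 0 \<and> b [^]\<^bsub>S\<^esub> k \<in> h ` Q"
      using k xy by (auto simp: hom_nat_pow)
  qed
qed

lemma radical_image:
  assumes "Q \<subseteq> carrier R"
  shows "radical S (h ` Q) = h ` radical R Q"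
proof -
  have "h x \<in> radical S (h ` Q) \<longleftrightarrow> x \<in> radical R Q" if "x \<in> carrier R" for x
    using that mem_image_iff[OF _ assms] by (simp add: radical_def flip: hom_nat_pow)
  moreover have "radical S (h ` Q) \<subseteq> h ` carrier R" "radical R Q \<subseteq> carrier R"
    by (auto simp: radical_def surj)
  ultimately show ?thesis by blast
qed

text \<open>Images commute with intersections where the map is injective, here inside the carrier.
  For the empty family the equation is surjectivity of \<open>h\<close>.\<close>

lemma image_Inter:
  assumes "\<And>Q. Q \<in> \<Q> \<Longrightarrow> Q \<subseteq> carrier R"
  shows "h ` (carrier R \<inter> \<Inter> \<Q>) = carrier S \<inter> \<Inter> ((`) h ` \<Q>)"
proof -
  have "h x \<in> \<Inter> ((`) h ` \<Q>) \<longleftrightarrow> x \<in> \<Inter> \<Q>" if "x \<in> carrier R" for x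
    using that mem_image_iff assms by simp
  then show ?thesis
    unfolding surj[symmetric] by (rule image_Int_vimage_eq)
qed

lemma image_primary_decomposition:
  assumes "primary_decomposition R I \<Q>"
  shows "primary_decomposition S (h ` I) ((`) h ` \<Q>)"
proof -
  have "h ` I = carrier S \<inter> \<Inter> ((`) h ` \<Q>)"
    using assms image_Inter[OF primary_decomposition_subset_carrier[OF assms]]
    by (simp add: primary_decomposition_def)
  with assms show ?thesis
    by (auto simp: primary_decomposition_def image_primaryideal)
qed

lemma image_minimal_primary_decomposition:
  assumes "minimal_primary_decomposition R I \<Q>"
  shows "minimal_primary_decomposition S (h ` I) ((`) h ` \<Q>)"
proof -
  have pd: "primary_decomposition R I \<Q>"
    and rad: "\<And>Q Q'. \<lbrakk>Q \<in> \<Q>; Q' \<in> \<Q>; Q \<noteq> Q'\<rbrakk> \<Longrightarrow> radical R Q \<noteq> radical R Q'"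
    and irr: "\<And>Q. Q \<in> \<Q> \<Longrightarrow> \<not> carrier R \<inter> \<Inter> (\<Q> - {Q}) \<subseteq> Q"
    using assms unfolding minimal_primary_decomposition_def by blast+
  note Qc = primary_decomposition_subset_carrier[OF pd]
  have rad_carrier: "radical R Q \<subseteq> carrier R" for Q
    by (auto simp: radical_def)
  \<comment> \<open>Radicals lie in the carrier, so distinct radicals have distinct images under
    \<open>h\<close>.\<close>
  have rad': "radical S (h ` Q) \<noteq> radical S (h ` Q')"
    if "Q \<in> \<Q>" "Q' \<in> \<Q>" "h ` Q \<noteq> h ` Q'" for Q Q'
    using that rad[of Q Q'] Qc
    by (auto simp: radical_image inj_on_image_eq_iff[OF inj rad_carrier rad_carrier])
  have irr': "\<not> carrier S \<inter> \<Inter> ((`) h ` \<Q> - {h ` Q}) \<subseteq> h ` Q" if Q: "Q \<in> \<Q>" for Q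
  proof
    assume sub: "carrier S \<inter> \<Inter> ((`) h ` \<Q> - {h ` Q}) \<subseteq> h ` Q"
    have "h ` Q' = h ` Q \<longleftrightarrow> Q' = Q" if "Q' \<in> \<Q>" for Q'
      by (rule inj_on_image_eq_iff[OF inj Qc[OF that] Qc[OF Q]])
    then have "(`) h ` \<Q> - {h ` Q} = (`) h ` (\<Q> - {Q})"
      by auto
    then have eq: "h ` (carrier R \<inter> \<Inter> (\<Q> - {Q})) = carrier S \<inter> \<Inter> ((`) h ` \<Q> - {h ` Q})"
      using image_Inter[of "\<Q> - {Q}"] Qc by simp
    obtain x where x: "x \<in> carrier R \<inter> \<Inter> (\<Q> - {Q})" "x \<notin> Q"
      using irr[OF Q] by blast
    have "h x \<in> h ` Q"
      using sub imageI[OF x(1), of h] unfolding eq by (rule subsetD)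
    then show False
      using x mem_image_iff[OF _ Qc[OF Q]] by simp
  qed
  show ?thesis
    unfolding minimal_primary_decomposition_def
  proof (intro conjI ballI impI image_primary_decomposition[OF pd])
    fix Y Y' assume "Y \<in> (`) h ` \<Q>" "Y' \<in> (`) h ` \<Q>" "Y \<noteq> Y'"
    then show "radical S Y \<noteq> radical S Y'" using rad' by blast
  next
    fix Y assume "Y \<in> (`) h ` \<Q>"
    then show "\<not> carrier S \<inter> \<Inter> ((`) h ` \<Q> - {Y}) \<subseteq> Y"
      by (rule imageE) (simp only: irr' not_False_eq_True)
  qed
qed

end

section \<open>Substitution homomorphisms\<close>

lemma poly_mapping_sum_singles:
  fixes f :: "'a \<Rightarrow>\<^sub>0 'b::comm_monoid_add"
  shows "(\<Sum>m \<in> Poly_Mapping.keys f. Poly_Mapping.single m (Poly_Mapping.lookup f m)) = f"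
proof (rule poly_mapping_eqI)
  fix k
  show "Poly_Mapping.lookup
      (\<Sum>m \<in> Poly_Mapping.keys f. Poly_Mapping.single m (Poly_Mapping.lookup f m)) k =
      Poly_Mapping.lookup f k"
    by (cases "k \<in> Poly_Mapping.keys f")
      (auto simp: lookup_sum lookup_single when_def in_keys_iff sum.delta)
qed

text \<open>Every finitely supported map is a finite sum of one-point maps. The rule serves both for
  polynomials and for exponent vectors.\<close>

lemma poly_mapping_single_add_induct [case_names zero single add]:
  fixes f :: "'a \<Rightarrow>\<^sub>0 'b::comm_monoid_add"
  assumes "P 0" "\<And>m c. P (Poly_Mapping.single m c)" "\<And>f g. P f \<Longrightarrow> P g \<Longrightarrow> P (f + g)"
  shows "P f"
proof -
  have "P (\<Sum>m \<in> A. Poly_Mapping.single m (Poly_Mapping.lookup f m))" if "finite A" for A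
    using that by induction (auto intro: assms)
  from this[OF finite_keys, of f] show ?thesis by (simp add: poly_mapping_sum_singles)
qed

definition monomial_subst :: "(nat \<Rightarrow>\<^sub>0 nat) \<Rightarrow> (nat \<Rightarrow> 'k::field mvpoly) \<Rightarrow> 'k mvpoly" where
  "monomial_subst m g = (\<Prod>i \<in> Poly_Mapping.keys m. g i ^ Poly_Mapping.lookup m i)"

text \<open>Extra indices contribute \<open>g i ^ 0 = 1\<close>. Two monomials can thus be evaluated
  over one common index set.\<close>

lemma monomial_subst_superset:
  "finite A \<Longrightarrow> Poly_Mapping.keys m \<subseteq> A \<Longrightarrow>
    monomial_subst m g = (\<Prod>i \<in> A. g i ^ Poly_Mapping.lookup m i)"
  unfolding monomial_subst_def by (rule prod.mono_neutral_left) (auto simp: in_keys_iff)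

lemma monomial_subst_zero: "monomial_subst 0 g = 1"
  by (simp add: monomial_subst_def)

lemma monomial_subst_add:
  "monomial_subst (m + m') g = monomial_subst m g * monomial_subst m' g"
proof -
  let ?A = "Poly_Mapping.keys m \<union> Poly_Mapping.keys m'"
  have "monomial_subst (m + m') g = (\<Prod>i \<in> ?A. g i ^ Poly_Mapping.lookup (m + m') i)"
    by (intro monomial_subst_superset) (use Poly_Mapping.keys_add[of m m'] in auto)
  then show ?thesis
    by (simp add: monomial_subst_superset[of ?A] lookup_add power_add prod.distrib)
qed

lemma monomial_subst_var: "monomial_subst m mvpoly_var = Poly_Mapping.single m (1::'k::field)"
proof (induction m rule: poly_mapping_single_add_induct)
  case (single i k)
  have "(mvpoly_var i :: 'k mvpoly) ^ k = Poly_Mapping.single (Poly_Mapping.single i k) 1"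
    by (induction k) (simp_all add: mvpoly_var_def mult_single single_add[symmetric])
  then show ?case
    by (simp add: monomial_subst_superset[of "{i}"])
qed (simp_all add: monomial_subst_zero monomial_subst_add mult_single)

text \<open>Extra monomials have coefficient 0. A common index set is what additivity needs, because
  cancellation may make the support of a sum smaller than the union of the supports.\<close>

lemma mvpoly_subst_superset:
  assumes "finite A" "Poly_Mapping.keys f \<subseteq> A"
  shows "mvpoly_subst f g =
    (\<Sum>m \<in> A. mvpoly_const (Poly_Mapping.lookup f m) * monomial_subst m g)"
  unfolding mvpoly_subst_def monomial_subst_def[symmetric]
  by (rule sum.mono_neutral_left)
    (use assms in \<open>auto simp: in_keys_iff mvpoly_const_def\<close>)

lemma mvpoly_subst_single:
  "mvpoly_subst (Poly_Mapping.single m c) g = mvpoly_const c * monomial_subst m g"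
  by (subst mvpoly_subst_superset[of "{m}"]) auto

lemma mvpoly_subst_zero: "mvpoly_subst 0 g = 0"
  by (simp add: mvpoly_subst_def)

lemma mvpoly_subst_const: "mvpoly_subst (mvpoly_const c) g = mvpoly_const c"
  by (simp add: mvpoly_const_def mvpoly_subst_single monomial_subst_zero)

lemma mvpoly_subst_one: "mvpoly_subst 1 g = 1"
  using mvpoly_subst_const[of 1 g] by (simp add: mvpoly_const_def)

lemma mvpoly_subst_var: "mvpoly_subst (mvpoly_var i) g = g i"
  by (simp add: mvpoly_var_def mvpoly_subst_single mvpoly_const_def monomial_subst_def)

lemma mvpoly_subst_add: "mvpoly_subst (f + f') g = mvpoly_subst f g + mvpoly_subst f' g"
proof -
  let ?A = "Poly_Mapping.keys f \<union> Poly_Mapping.keys f'"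
  have "mvpoly_subst (f + f') g =
      (\<Sum>m \<in> ?A. mvpoly_const (Poly_Mapping.lookup (f + f') m) * monomial_subst m g)"
    by (intro mvpoly_subst_superset) (use Poly_Mapping.keys_add[of f f'] in auto)
  then show ?thesis
    by (simp add: mvpoly_subst_superset[of ?A] lookup_add mvpoly_const_def single_add
        distrib_right sum.distrib)
qed

text \<open>Both sides are additive in each factor, so induction on \<open>f\<close> and then on
  \<open>f'\<close> leaves two single terms, where exponents add.\<close>

lemma mvpoly_subst_mult: "mvpoly_subst (f * f') g = mvpoly_subst f g * mvpoly_subst f' g"
proof (induction f rule: poly_mapping_single_add_induct)
  case (single m c)
  show ?case
  proof (induction f' rule: poly_mapping_single_add_induct)
    case (single m' c')
    have "mvpoly_const (c * c') = mvpoly_const c * mvpoly_const c'"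
      by (simp add: mvpoly_const_def mult_single)
    then show ?case
      by (simp add: mult_single mvpoly_subst_single monomial_subst_add mult_ac)
  qed (simp_all add: mvpoly_subst_zero mvpoly_subst_add distrib_left)
qed (simp_all add: mvpoly_subst_zero mvpoly_subst_add distrib_right)

lemma mvpoly_subst_power: "mvpoly_subst (f ^ k) g = mvpoly_subst f g ^ k"
  by (induction k) (simp_all add: mvpoly_subst_one mvpoly_subst_mult)

lemma mvpoly_subst_prod: "mvpoly_subst (prod F A) g = (\<Prod>i \<in> A. mvpoly_subst (F i) g)"
  by (induction A rule: infinite_finite_induct)
    (simp_all add: mvpoly_subst_one mvpoly_subst_mult)

text \<open>Both sides are additive in \<open>f\<close>; on a single term the outer substitution
  fixes the coefficient and passes through the product and the powers.\<close>

lemma mvpoly_subst_mvpoly_subst: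
  "mvpoly_subst (mvpoly_subst f g) g' = mvpoly_subst f (\<lambda>i. mvpoly_subst (g i) g')"
proof (induction f rule: poly_mapping_single_add_induct)
  case (single m c)
  then show ?case
    by (simp add: mvpoly_subst_single mvpoly_subst_mult mvpoly_subst_const monomial_subst_def
        mvpoly_subst_prod mvpoly_subst_power)
qed (simp_all add: mvpoly_subst_zero mvpoly_subst_add)

lemma mvpoly_subst_mvpoly_var: "mvpoly_subst f mvpoly_var = f"
  by (induction f rule: poly_mapping_single_add_induct)
    (simp_all add: mvpoly_subst_zero mvpoly_subst_add mvpoly_subst_single monomial_subst_var
      mvpoly_const_def mult_single)

text \<open>The result is built from constants and values \<open>g i\<close> by ring operations, and
  only indices \<open>i\<close> in \<open>{1..n}\<close> occur in the monomials of
  \<open>f\<close>.\<close>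

lemma mvpoly_subst_closed:
  assumes "f \<in> carrier (mvpoly_ring n)"
    and g: "\<And>i. i \<in> {1..n} \<Longrightarrow> g i \<in> carrier (mvpoly_ring n)"
  shows "mvpoly_subst f g \<in> carrier (mvpoly_ring n :: 'k::field mvpoly ring)"
proof -
  let ?R = "mvpoly_ring n :: 'k mvpoly ring"
  interpret R: cring ?R by (rule mvpoly_ring_cring)
  have add: "a + b \<in> carrier ?R" and mult: "a * b \<in> carrier ?R"
    if "a \<in> carrier ?R" "b \<in> carrier ?R" for a b
    using R.a_closed[OF that] R.m_closed[OF that] by (simp_all add: mvpoly_ring_def)
  have zero: "0 \<in> carrier ?R" and one: "1 \<in> carrier ?R" and const: "mvpoly_const c \<in> carrier ?R" for c
    by (simp_all add: mvpoly_ring_def mvpoly_const_def)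
  have power: "a ^ k \<in> carrier ?R" if "a \<in> carrier ?R" for a and k :: nat
    by (induction k) (auto intro: one mult that)
  have prod: "prod F A \<in> carrier ?R" if "\<And>i. i \<in> A \<Longrightarrow> F i \<in> carrier ?R"
    for A and F :: "nat \<Rightarrow> 'k mvpoly"
    using that by (induction A rule: infinite_finite_induct) (auto intro: one mult)
  have sum: "sum F A \<in> carrier ?R" if "\<And>m. m \<in> A \<Longrightarrow> F m \<in> carrier ?R"
    for A and F :: "(nat \<Rightarrow>\<^sub>0 nat) \<Rightarrow> 'k mvpoly"
    using that by (induction A rule: infinite_finite_induct) (auto intro: zero add)
  show ?thesis
    unfolding mvpoly_subst_def
  proof (intro sum mult const prod power g)
    fix m i assume "m \<in> Poly_Mapping.keys f" "i \<in> Poly_Mapping.keys m"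
    moreover from this assms(1) have "Poly_Mapping.keys m \<subseteq> {1..n}"
      by (simp add: mvpoly_ring_def)
    ultimately show "i \<in> {1..n}" by blast
  qed
qed

section \<open>The action of permutations\<close>

text \<open>The inner action sends variable \<open>i\<close> to variable \<open>\<tau> i\<close>,
  which the outer one sends to \<open>\<sigma> (\<tau> i)\<close>: a left action.\<close>

lemma perm_act_comp: "perm_act \<sigma> (perm_act \<tau> f) = perm_act (\<sigma> \<circ> \<tau>) f"
  by (simp add: perm_act_def mvpoly_subst_mvpoly_subst mvpoly_subst_var)

lemma perm_act_id: "perm_act id f = f"
  by (simp add: perm_act_def mvpoly_subst_mvpoly_var)

lemma perm_act_closed:
  assumes "\<sigma> permutes {1..n}" "f \<in> carrier (mvpoly_ring n)"
  shows "perm_act \<sigma> f \<in> carrier (mvpoly_ring n)"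
  unfolding perm_act_def
proof (rule mvpoly_subst_closed[OF assms(2)])
  fix i assume "i \<in> {1..n}"
  then have "\<sigma> i \<in> {1..n}" using permutes_in_image[OF assms(1)] by blast
  then show "mvpoly_var (\<sigma> i) \<in> carrier (mvpoly_ring n)"
    by (simp add: mvpoly_var_def mvpoly_ring_def)
qed

lemma perm_act_ring_iso:
  assumes "\<sigma> permutes {1..n}"
  shows "perm_act \<sigma> \<in> ring_iso (mvpoly_ring n) (mvpoly_ring n :: 'k::field mvpoly ring)"
proof (rule ring_iso_memI)
  let ?C = "carrier (mvpoly_ring n :: 'k mvpoly ring)"
  show "bij_betw (perm_act \<sigma>) ?C ?C"
    \<comment> \<open>By the composition law, the action of the inverse permutation is a two-sided
      inverse; it preserves the carrier because the inverse again permutes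
      \<open>{1..n}\<close>.\<close>
    by (rule bij_betw_byWitness[where f' = "perm_act (inv_into UNIV \<sigma>)"])
      (auto simp: perm_act_comp permutes_inv_o[OF assms] perm_act_id
        intro!: perm_act_closed assms permutes_inv)
qed (auto simp: perm_act_closed[OF assms],
    auto simp: mvpoly_ring_def perm_act_def mvpoly_subst_add mvpoly_subst_mult mvpoly_subst_one)

theorem lemma3p1p1:
  fixes n :: nat
    and G :: "(nat \<Rightarrow> nat) set"
    and I :: "'k::field mvpoly set"
    and \<sigma> :: "nat \<Rightarrow> nat"
    and \<Q> :: "'k mvpoly set set"
  assumes "subgroup G (sym_group n)"
    and "ideal I (mvpoly_ring n)"
    and "I \<noteq> carrier (mvpoly_ring n)"
    and "perm_invariant G I"
    and "\<sigma> \<in> G"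
    and "primary_decomposition (mvpoly_ring n) I \<Q>"
  shows "primary_decomposition (mvpoly_ring n) I ((\<lambda>Q. perm_act \<sigma> ` Q) ` \<Q>) \<and>
         (minimal_primary_decomposition (mvpoly_ring n) I \<Q> \<longrightarrow>
          minimal_primary_decomposition (mvpoly_ring n) I ((\<lambda>Q. perm_act \<sigma> ` Q) ` \<Q>))"
proof -
  let ?R = "mvpoly_ring n :: 'k mvpoly ring"
  have "\<sigma> permutes {1..n}"
    using subgroup.mem_carrier[OF assms(1,5)] by (simp add: sym_group_carrier)
  then interpret ring_iso_cring ?R ?R "perm_act \<sigma>"
    by (intro ring_iso_cring.intro ring_iso_cring_axioms.intro mvpoly_ring_cring perm_act_ring_iso)
  have "perm_act \<sigma> ` I = I"
    using assms(4,5) by (simp add: perm_invariant_def)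
  then show ?thesis
    using image_primary_decomposition[OF assms(6)] image_minimal_primary_decomposition[of I \<Q>]
    by simp
qed

end
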